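(* For every integer $t\in\{0,3,4,5\}\cup\{8,9,10,\dots\}$ (that is, $t\in\{0,3,4,5\}$ or $t\ge 8$), there exist infinitely many pairwise non-isomorphic connected graphs $G$ with $A^*(G)=2t$.
   Context: All graphs are simple and finite. For a graph $G$ with edge set $E(G)$, $d_u$ denotes the degree of the vertex $u$ in $G$. The modified Albertson index of $G$ is $A^*(G)=\sum_{uv\in E(G)} |(d_u)^2-(d_v)^2|$. *)

theory Defs
  imports "Graph_Theory.Digraph_Isomorphism"
begin

text \<open>
  A finite simple graph is a \<^locale>\<open>pair_graph\<close>: a finite loop-free digraph with symmetric arc set,
  so that every undirected edge \<open>{u, v}\<close> is represented by the two arcs \<open>(u, v)\<close> and \<open>(v, u)\<close>.
  Consequently the degree of a vertex is its out-degree, and \<^const>\<open>digraph_iso\<close> on such graphs is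
  the usual graph isomorphism.
\<close>

definition undirected_edges :: "'a pair_pre_digraph \<Rightarrow> 'a set set" where
  "undirected_edges G = {{u, v} | u v. (u, v) \<in> parcs G}"

abbreviation degree :: "'a pair_pre_digraph \<Rightarrow> 'a \<Rightarrow> nat" where
  "degree G u \<equiv> out_degree (with_proj G) u"

text \<open>
  The description below is unambiguous since the expression is symmetric in \<open>u\<close> and \<open>v\<close>;
  see \<open>edge_imbalance_doubleton\<close>.
\<close>

definition edge_imbalance :: "'a pair_pre_digraph \<Rightarrow> 'a set \<Rightarrow> int" where
  "edge_imbalance G e =
     (THE k. \<exists>u v. e = {u, v} \<and> k = \<bar>(int (degree G u))\<^sup>2 - (int (degree G v))\<^sup>2\<bar>)"

lemma edge_imbalance_doubleton:
  "edge_imbalance G {u, v} = \<bar>(int (degree G u))\<^sup>2 - (int (degree G v))\<^sup>2\<bar>"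
  unfolding edge_imbalance_def
  by (rule the_equality) (auto simp: doubleton_eq_iff abs_minus_commute)

definition modified_albertson :: "'a pair_pre_digraph \<Rightarrow> int" where
  "modified_albertson G = (\<Sum>e\<in>undirected_edges G. edge_imbalance G e)"

end

theory Submission
  imports Defs
begin

text \<open>
  Everything is built with one operation: subdivide an edge \<open>uv\<close> by a new vertex \<open>w\<close> and hang \<open>k\<close>
  new leaves on \<open>w\<close>. No old vertex changes its degree, so the index changes only by the terms of the
  edges that are removed or created (\<open>modified_albertson_H\<close>). Three instances matter.

  Let \<open>d\<^sub>u = d\<^sub>v = 3\<close>. With \<open>k = 0\<close> the index grows by \<open>2 \<cdot> (9 - 4) = 10\<close>, and one edge between vertices of
  degree 3 (a cubic edge) is lost. With \<open>k = 1\<close> the new vertex has degree 3 as well, so the index grows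
  only by the contribution \<open>9 - 1 = 8\<close> of the pendant edge, and cubic edges are never used up.
  Start from \<open>K\<^sub>4\<close>, which has index 0 and six cubic edges: first use \<open>k = 1\<close> as often as wanted and then
  \<open>k = 0\<close> at most five times. This realises every \<open>2 * t = 8 * p + 10 * s\<close> with \<open>s \<le> 5\<close>, and choosing \<open>s\<close> as the
  residue of \<open>t\<close> modulo 4 reaches every admissible \<open>t\<close> other than 0, 3 and 11.

  The remaining values come from a single operation on a complete graph, whose index is 0: subdividing
  an edge of \<open>K\<^sub>3\<close> gives 0, subdividing the edge of \<open>K\<^sub>2\<close> gives the path with index \<open>6 = 2 \<cdot> 3\<close>, and
  subdividing an edge of \<open>K\<^sub>5\<close> and hanging one leaf on the new vertex gives \<open>2 \<cdot> (16 - 9) + (9 - 1) = 22 = 2 \<cdot> 11\<close>.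

  Finally let \<open>d\<^sub>u \<le> 2 \<le> d\<^sub>v\<close>. With \<open>k = 0\<close> the two new differences \<open>4 - d\<^sub>u\<^sup>2\<close> and \<open>d\<^sub>v\<^sup>2 - 4\<close> add up to
  the old one, so the index is unchanged and there is again an edge of this kind
  (\<open>subdivide_edge_across_2\<close>). Every graph produced above by at least one
  operation has such an edge, and repeating the subdivision yields
  graphs with the same index on more and more vertices; their vertex numbers tell them apart.
\<close>

section \<open>Degree and connectedness of symmetric pair graphs\<close>

lemma degree_card_neighbours: "degree G x = card {y. (x, y) \<in> parcs G}"
proof -
  have "out_arcs (with_proj G) x = Pair x ` {y. (x, y) \<in> parcs G}"
    by (auto simp: out_arcs_def)
  then show ?thesis
    by (simp add: out_degree_def card_image inj_on_def)
qed

lemma (in pair_graph) connected_iff_rtrancl: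
  "Digraph_Component.connected (with_proj G) \<longleftrightarrow>
     pverts G \<noteq> {} \<and> (\<forall>x\<in>pverts G. \<forall>y\<in>pverts G. (x, y) \<in> (parcs G)\<^sup>*)"
proof -
  have sym: "(parcs G)\<^sup>s = parcs G"
    by (auto simp: symcl_def intro: arcs_symmetric)
  have "(x, y) \<in> rtrancl_on (pverts G) (parcs G) \<longleftrightarrow> (x, y) \<in> (parcs G)\<^sup>*"
    if "x \<in> pverts G" for x y
  proof
    assume "(x, y) \<in> (parcs G)\<^sup>*"
    then show "(x, y) \<in> rtrancl_on (pverts G) (parcs G)"
      using that by induction (auto intro: rtrancl_on.intros dest: wellformed')
  qed (rule rtrancl_on_rtranclI)
  then show ?thesis
    by (auto simp: connected_conv sym)
qed

lemma undirected_edges_image: "undirected_edges G = (\<lambda>(x, y). {x, y}) ` parcs G"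
  by (auto simp: undirected_edges_def)

text \<open>
  Deleting both arcs of an edge deletes exactly that edge, because \<open>(u, v)\<close> and \<open>(v, u)\<close> are the only
  ordered representatives of \<open>{u, v}\<close>.
\<close>

lemma image_doubleton_delete:
  "(\<lambda>(x, y). {x, y}) ` (A - {(u, v), (v, u)}) = (\<lambda>(x, y). {x, y}) ` A - {{u, v}}"
proof -
  have "(\<lambda>(x, y). {x, y}) -` {{u, v}} = {(u, v), (v, u)}"
  proof (intro set_eqI, clarify)
    fix x y
    show "(x, y) \<in> (\<lambda>(x, y). {x, y}) -` {{u, v}} \<longleftrightarrow> (x, y) \<in> {(u, v), (v, u)}"
      by (simp add: doubleton_eq_iff)
  qed
  moreover have "f ` (A - f -` B) = f ` A - B" for f :: "'a \<times> 'a \<Rightarrow> 'a set" and B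
    by blast
  ultimately show ?thesis by metis
qed

lemma digraph_iso_card_pverts:
  assumes "digraph_iso (with_proj G) (with_proj H)"
  shows "card (pverts G) = card (pverts H)"
proof -
  obtain f where f: "pre_digraph.digraph_isomorphism (with_proj G) f"
    and H: "with_proj H = app_iso f (with_proj G)"
    using assms unfolding digraph_iso_def by blast
  have "verts (with_proj H) = iso_verts f ` verts (with_proj G)"
    unfolding H by simp
  moreover have "inj_on (iso_verts f) (pverts G)"
    using f unfolding pre_digraph.digraph_isomorphism_def by simp
  ultimately show ?thesis
    by (simp add: card_image)
qed

section \<open>Subdividing an edge and hanging leaves on the new vertex\<close>

text \<open>
  The leaves are given by a set \<open>L\<close>, so that subdivision alone (\<open>L = {}\<close>) and subdivision with a
  pendant edge share all computations below.
\<close>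

definition subdivide_with_leaves ::
  "'a pair_pre_digraph \<Rightarrow> 'a \<Rightarrow> 'a \<Rightarrow> 'a \<Rightarrow> 'a set \<Rightarrow> 'a pair_pre_digraph" where
  "subdivide_with_leaves G u v w L =
     \<lparr> pverts = insert w (pverts G) \<union> L,
       parcs = parcs (subdivide G (u, v) w) \<union> {w} \<times> L \<union> L \<times> {w} \<rparr>"

locale edge_subdivision = pair_graph G for G :: "'a pair_pre_digraph" +
  fixes u v w :: 'a and L :: "'a set"
  assumes uv: "(u, v) \<in> parcs G"
    and w_new: "w \<notin> pverts G"
    and L_new: "L \<inter> pverts G = {}" "w \<notin> L"
    and finite_L: "finite L"
begin

abbreviation H where "H \<equiv> subdivide_with_leaves G u v w L"

lemma vu: "(v, u) \<in> parcs G"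
  using uv by (rule arcs_symmetric)

lemma ends: "u \<in> pverts G" "v \<in> pverts G" "u \<noteq> v" "u \<noteq> w" "v \<noteq> w"
  using uv w_new by (auto dest: wellformed' no_loops')

lemma pverts_H: "pverts H = insert w (pverts G) \<union> L"
  by (simp add: subdivide_with_leaves_def)

lemma parcs_H:
  "parcs H = (parcs G - {(u, v), (v, u)}) \<union> {(u, w), (w, u), (w, v), (v, w)} \<union> {w} \<times> L \<union> L \<times> {w}"
  by (simp add: subdivide_with_leaves_def)

lemma card_pverts_H: "card (pverts H) = card (pverts G) + 1 + card L"
proof -
  have "card (insert w (pverts G) \<union> L) = card (insert w (pverts G)) + card L"
    using L_new finite_L pair_finite_verts by (intro card_Un_disjoint) auto
  then show ?thesis
    using w_new pair_finite_verts by (simp add: pverts_H)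
qed

lemma pair_graph_H: "pair_graph H"
proof
  show "\<And>e. e \<in> parcs H \<Longrightarrow> fst e \<in> pverts H" "\<And>e. e \<in> parcs H \<Longrightarrow> snd e \<in> pverts H"
    using ends by (auto simp: parcs_H pverts_H dest: wellformed')
  show "finite (pverts H)" "finite (parcs H)"
    using finite_L pair_finite_verts pair_finite_arcs by (simp_all add: parcs_H pverts_H)
  show "\<And>e. e \<in> parcs H \<Longrightarrow> fst e \<noteq> snd e"
    using ends L_new by (auto simp: parcs_H dest: no_loops')
  show "symmetric (with_proj H)"
    by (auto simp: symmetric_def parcs_H intro!: symI intro: arcs_symmetric)
qed

text \<open>
  A walk of \<open>G\<close> survives by taking the detour through \<open>w\<close> whenever it used the edge \<open>uv\<close>, and the new
  vertices are attached to \<open>u\<close>. Hence all vertices can be reached from \<open>u\<close>, which suffices by symmetry.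
\<close>

lemma connected_H:
  assumes "Digraph_Component.connected (with_proj G)"
  shows "Digraph_Component.connected (with_proj H)"
proof -
  interpret H: pair_graph H by (rule pair_graph_H)
  have arc: "(x, y) \<in> (parcs H)\<^sup>*" if "(x, y) \<in> parcs G" for x y
  proof (cases "(x, y) \<in> {(u, v), (v, u)}")
    case True
    then have "(x, w) \<in> parcs H" "(w, y) \<in> parcs H" by (auto simp: parcs_H)
    then show ?thesis by (meson r_into_rtrancl rtrancl_trans)
  next
    case False
    then show ?thesis using that by (auto simp: parcs_H)
  qed
  have old: "(x, y) \<in> (parcs H)\<^sup>*" if "(x, y) \<in> (parcs G)\<^sup>*" for x y
  proof -
    have "parcs G \<subseteq> (parcs H)\<^sup>*" using arc by (rule subrelI)
    then show ?thesis using that rtrancl_subset_rtrancl by blast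
  qed
  have uw: "(u, w) \<in> (parcs H)\<^sup>*" by (auto simp: parcs_H)
  have from_u: "(u, x) \<in> (parcs H)\<^sup>*" if x: "x \<in> pverts H" for x
  proof -
    consider "x \<in> pverts G" | "x = w" | "x \<in> L" using x by (auto simp: pverts_H)
    then show ?thesis
    proof cases
      case 1
      then show ?thesis using assms ends old by (auto simp: connected_iff_rtrancl)
    next
      case 3
      then have "(w, x) \<in> parcs H" by (auto simp: parcs_H)
      with uw show ?thesis by (rule rtrancl_into_rtrancl)
    qed (simp add: uw)
  qed
  have "sym ((parcs H)\<^sup>*)"
    by (intro sym_rtrancl symI) (rule H.arcs_symmetric)
  then show ?thesis
    using from_u by (auto simp: H.connected_iff_rtrancl pverts_H dest: symD intro: rtrancl_trans)
qed

text \<open>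
  The ends of the subdivided edge exchange one neighbour for \<open>w\<close>; no other old vertex is affected.
\<close>

lemma degree_old: "x \<in> pverts G \<Longrightarrow> degree H x = degree G x"
proof -
  assume x: "x \<in> pverts G"
  have fin: "finite {y. (a, y) \<in> parcs G}" for a
    by (rule finite_subset[of _ "pverts G"]) (auto dest: wellformed' simp: pair_finite_verts)
  have swap: "card (insert w (A - {b})) = card A" if "finite A" "b \<in> A" "w \<notin> A" for A and b :: 'a
    using that card.remove[of A b] by simp
  have w: "w \<notin> {y. (a, y) \<in> parcs G}" for a using w_new by (auto dest: wellformed')
  consider "x = u" | "x = v" | "x \<noteq> u" "x \<noteq> v" by blast
  then show ?thesis
  proof cases
    case 1
    have "{y. (u, y) \<in> parcs H} = insert w ({y. (u, y) \<in> parcs G} - {v})"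
      using ends L_new by (auto simp: parcs_H)
    then show ?thesis using swap[OF fin _ w] uv by (simp add: degree_card_neighbours 1)
  next
    case 2
    have "{y. (v, y) \<in> parcs H} = insert w ({y. (v, y) \<in> parcs G} - {u})"
      using ends L_new by (auto simp: parcs_H)
    then show ?thesis using swap[OF fin _ w] vu by (simp add: degree_card_neighbours 2)
  next
    case 3
    then have "{y. (x, y) \<in> parcs H} = {y. (x, y) \<in> parcs G}"
      using x w_new L_new by (auto simp: parcs_H)
    then show ?thesis by (simp add: degree_card_neighbours)
  qed
qed

lemma degree_new: "degree H w = 2 + card L"
proof -
  have "{y. (w, y) \<in> parcs H} = {u, v} \<union> L"
    using w_new L_new by (auto simp: parcs_H dest: wellformed')
  moreover have "card ({u, v} \<union> L) = card {u, v} + card L"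
    using ends L_new finite_L by (intro card_Un_disjoint) auto
  ultimately show ?thesis using ends by (simp add: degree_card_neighbours)
qed

lemma degree_leaf: "l \<in> L \<Longrightarrow> degree H l = 1"
proof -
  assume "l \<in> L"
  then have "{y. (l, y) \<in> parcs H} = {w}"
    using ends L_new by (auto simp: parcs_H dest: wellformed')
  then show ?thesis by (simp add: degree_card_neighbours)
qed

text \<open>
  Since old degrees are unchanged, the old edges other than \<open>uv\<close> keep their contributions. The
  correction terms account for the lost edge, the two halves of the subdivided edge, and the pendant edges, which join
  degree \<open>2 + card L\<close> to degree 1.
\<close>

lemma modified_albertson_H:
  "modified_albertson H = modified_albertson G
     - \<bar>(int (degree G u))\<^sup>2 - (int (degree G v))\<^sup>2\<bar>
     + \<bar>(int (degree G u))\<^sup>2 - (2 + int (card L))\<^sup>2\<bar>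
     + \<bar>(int (degree G v))\<^sup>2 - (2 + int (card L))\<^sup>2\<bar>
     + int (card L) * ((2 + int (card L))\<^sup>2 - 1)"
proof -
  let ?E = "undirected_edges G - {{u, v}}" and ?F = "(\<lambda>l. {w, l}) ` L"
  have fin: "finite (undirected_edges G)"
    using pair_finite_arcs by (simp add: undirected_edges_image)
  have E_sub: "e \<subseteq> pverts G" if "e \<in> undirected_edges G" for e
    using that by (auto simp: undirected_edges_def dest: wellformed')
  have edges: "undirected_edges H = ?E \<union> ({{u, w}, {v, w}} \<union> ?F)"
  proof -
    have "(\<lambda>(x, y). {x, y}) ` (parcs G - {(u, v), (v, u)}) = ?E"
      unfolding undirected_edges_image by (rule image_doubleton_delete)
    moreover have "(\<lambda>(x, y). {x, y}) ` {(u, w), (w, u), (w, v), (v, w)} = {{u, w}, {v, w}}"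
      by (simp add: insert_commute)
    moreover have "(\<lambda>(x, y). {x, y}) ` ({w} \<times> L) = ?F" "(\<lambda>(x, y). {x, y}) ` (L \<times> {w}) = ?F"
      by (auto simp: insert_commute)
    ultimately show ?thesis
      unfolding undirected_edges_image[of H] parcs_H image_Un by (simp only: Un_assoc Un_absorb)
  qed
  have notin: "{u, w} \<noteq> {v, w}" "{u, w} \<notin> ?F" "{v, w} \<notin> ?F"
    using ends L_new by (auto simp: doubleton_eq_iff)
  have disj: "?E \<inter> ({{u, w}, {v, w}} \<union> ?F) = {}"
    using E_sub w_new by blast
  have old: "edge_imbalance H e = edge_imbalance G e" if e: "e \<in> undirected_edges G" for e
  proof -
    obtain x y where "e = {x, y}" "(x, y) \<in> parcs G"
      using e by (auto simp: undirected_edges_def)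
    moreover from this have "x \<in> pverts G" "y \<in> pverts G" by (auto dest: wellformed')
    ultimately show ?thesis by (simp add: edge_imbalance_doubleton degree_old)
  qed
  have leaves: "(\<Sum>e\<in>?F. edge_imbalance H e) = int (card L) * ((2 + int (card L))\<^sup>2 - 1)"
  proof -
    have "inj_on (\<lambda>l. {w, l}) L"
      using L_new by (auto simp: inj_on_def doubleton_eq_iff)
    then have "(\<Sum>e\<in>?F. edge_imbalance H e) = (\<Sum>l\<in>L. \<bar>(2 + int (card L))\<^sup>2 - 1\<bar>)"
      by (simp add: sum.reindex edge_imbalance_doubleton degree_new degree_leaf)
    moreover have "(2 + int (card L))\<^sup>2 \<ge> 1" by simp
    ultimately show ?thesis by simp
  qed
  have uv_edge: "{u, v} \<in> undirected_edges G"
    using uv by (auto simp: undirected_edges_def)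
  have "modified_albertson H = (\<Sum>e\<in>?E. edge_imbalance H e)
      + (edge_imbalance H {u, w} + edge_imbalance H {v, w} + (\<Sum>e\<in>?F. edge_imbalance H e))"
    unfolding modified_albertson_def edges
    using fin disj finite_L notin by (subst sum.union_disjoint) auto
  also have "(\<Sum>e\<in>?E. edge_imbalance H e) = (\<Sum>e\<in>?E. edge_imbalance G e)"
    by (intro sum.cong) (auto simp: old)
  also have "\<dots> = modified_albertson G - edge_imbalance G {u, v}"
    using fin uv_edge by (simp add: modified_albertson_def sum_diff1)
  finally show ?thesis
    using ends by (simp add: leaves edge_imbalance_doubleton degree_new degree_old)
qed

end

lemma edge_subdivision_exists:
  fixes G :: "nat pair_pre_digraph"
  assumes "pair_graph G" "(u, v) \<in> parcs G"
  obtains w L where "edge_subdivision G u v w L" "card L = k"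
proof -
  interpret pair_graph G by fact
  have "infinite (- pverts G)"
    using pair_finite_verts by simp
  then obtain A where A: "A \<subseteq> - pverts G" "finite A" "card A = Suc k"
    using infinite_arbitrarily_large by blast
  then obtain w L where "A = insert w L" "w \<notin> L" "card L = k"
    by (meson card_Suc_eq)
  with A assms have "edge_subdivision G u v w L"
    by unfold_locales auto
  then show thesis using that \<open>card L = k\<close> by blast
qed

section \<open>Complete graphs and their subdivided edges\<close>

definition connected_graph_with_index :: "nat pair_pre_digraph \<Rightarrow> int \<Rightarrow> bool" where
  "connected_graph_with_index G k \<longleftrightarrow>
     pair_graph G \<and> Digraph_Component.connected (with_proj G) \<and> modified_albertson G = k"

definition complete_graph :: "nat \<Rightarrow> nat pair_pre_digraph" where
  "complete_graph n = \<lparr> pverts = {..<n}, parcs = {(x, y). x < n \<and> y < n \<and> x \<noteq> y} \<rparr>"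

lemma pair_graph_complete_graph: "pair_graph (complete_graph n)"
proof
  have "parcs (complete_graph n) \<subseteq> {..<n} \<times> {..<n}"
    by (auto simp: complete_graph_def)
  then show "finite (parcs (complete_graph n))"
    by (rule finite_subset) simp
qed (auto simp: complete_graph_def symmetric_def intro!: symI)

lemma degree_complete_graph: "x < n \<Longrightarrow> degree (complete_graph n) x = n - 1"
proof -
  assume "x < n"
  then have "{y. (x, y) \<in> parcs (complete_graph n)} = {..<n} - {x}"
    by (auto simp: complete_graph_def)
  then show ?thesis using \<open>x < n\<close> by (simp add: degree_card_neighbours)
qed

lemma complete_graph_with_index_0:
  assumes "0 < n"
  shows "connected_graph_with_index (complete_graph n) 0"
proof -
  interpret pair_graph "complete_graph n" by (rule pair_graph_complete_graph)
  have "(x, y) \<in> (parcs (complete_graph n))\<^sup>*" if "x < n" "y < n" for x y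
    using that by (cases "x = y") (auto simp: complete_graph_def)
  moreover have "pverts (complete_graph n) = {..<n}"
    by (simp add: complete_graph_def)
  ultimately have "Digraph_Component.connected (with_proj (complete_graph n))"
    using assms by (auto simp: connected_iff_rtrancl)
  moreover have "modified_albertson (complete_graph n) = 0"
    unfolding modified_albertson_def
  proof (intro sum.neutral ballI)
    fix e assume "e \<in> undirected_edges (complete_graph n)"
    then obtain x y where "e = {x, y}" "x < n" "y < n"
      by (auto simp: undirected_edges_def complete_graph_def)
    then show "edge_imbalance (complete_graph n) e = 0"
      by (simp add: edge_imbalance_doubleton degree_complete_graph)
  qed
  ultimately show ?thesis
    by (simp add: connected_graph_with_index_def pair_graph_complete_graph)
qed

text \<open>
  These are the edges whose subdivision leaves the index unchanged: a vertex of degree 2 fits between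
  their ends.
\<close>

definition has_edge_across_2 :: "'a pair_pre_digraph \<Rightarrow> bool" where
  "has_edge_across_2 G \<longleftrightarrow> (\<exists>(x, y)\<in>parcs G. degree G x \<le> 2 \<and> 2 \<le> degree G y)"

lemma has_edge_across_2I:
  "(x, y) \<in> parcs G \<Longrightarrow> degree G x \<le> 2 \<Longrightarrow> 2 \<le> degree G y \<Longrightarrow> has_edge_across_2 G"
  by (auto simp: has_edge_across_2_def)

text \<open>
  With no leaf, the new vertex itself has degree 2 and any edge at it will do; with one leaf, the pendant
  edge joins degrees 1 and 3.
\<close>

lemma (in edge_subdivision) has_edge_across_2_H:
  assumes "card L = 0 \<or> card L = 1"
  shows "has_edge_across_2 H"
  using assms
proof
  assume "card L = 0"
  then have w: "degree H w = 2" by (simp add: degree_new)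
  have "(u, w) \<in> parcs H" "(w, u) \<in> parcs H" by (auto simp: parcs_H)
  then show ?thesis
    by (cases "degree H u \<le> 2") (auto simp: w intro: has_edge_across_2I)
next
  assume "card L = 1"
  then obtain l where "l \<in> L" by force
  then show ?thesis
    by (intro has_edge_across_2I[of l w]) (auto simp: parcs_H degree_new degree_leaf)
qed

text \<open>
  The base cases: all degrees in the complete graph are equal, so the subdivided edge itself contributed
  nothing before.
\<close>

lemma subdivide_complete_graph:
  assumes "2 \<le> n" "c = 0 \<or> c = 1"
  shows "\<exists>G. connected_graph_with_index G
      (2 * \<bar>(int n - 1)\<^sup>2 - (2 + int c)\<^sup>2\<bar> + int c * ((2 + int c)\<^sup>2 - 1)) \<and> has_edge_across_2 G"
proof -
  have "(0, 1) \<in> parcs (complete_graph n)"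
    using assms by (auto simp: complete_graph_def)
  then obtain w L where "edge_subdivision (complete_graph n) 0 1 w L" and L: "card L = c"
    using edge_subdivision_exists[OF pair_graph_complete_graph] by metis
  then interpret edge_subdivision "complete_graph n" 0 1 w L by blast
  have "connected_graph_with_index (complete_graph n) 0"
    using assms by (intro complete_graph_with_index_0) simp
  then have "connected_graph_with_index H
      (2 * \<bar>(int n - 1)\<^sup>2 - (2 + int c)\<^sup>2\<bar> + int c * ((2 + int c)\<^sup>2 - 1))"
    using assms pair_graph_H connected_H modified_albertson_H
    by (simp add: connected_graph_with_index_def degree_complete_graph L of_nat_diff)
  moreover have "has_edge_across_2 H"
    using assms by (intro has_edge_across_2_H) (simp add: L)
  ultimately show ?thesis by blast
qed

section \<open>Replacing edges between vertices of degree three\<close>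

text \<open>
  Arcs rather than edges are counted, so every edge appears twice: the six edges of \<open>K\<^sub>4\<close> give 12.
\<close>

definition cubic_arcs :: "'a pair_pre_digraph \<Rightarrow> ('a \<times> 'a) set" where
  "cubic_arcs G = {(x, y) \<in> parcs G. degree G x = 3 \<and> degree G y = 3}"

lemma card_cubic_arcs_K4: "card (cubic_arcs (complete_graph 4)) = 12"
proof -
  have "cubic_arcs (complete_graph 4) = ({..<4} \<times> {..<4}) - (\<lambda>x. (x, x)) ` {..<4::nat}"
    by (auto simp: cubic_arcs_def degree_complete_graph) (auto simp: complete_graph_def)
  also have "card \<dots> = card ({..<4::nat} \<times> {..<4::nat}) - card ((\<lambda>x. (x, x)) ` {..<4::nat})"
    by (intro card_Diff_subset) auto
  finally show ?thesis
    by (simp add: card_image inj_on_def)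
qed

lemma (in edge_subdivision) old_cubic_arcs:
  "cubic_arcs G - {(u, v), (v, u)} \<subseteq> cubic_arcs H"
  by (auto simp: cubic_arcs_def parcs_H degree_old dest: wellformed')

lemma (in edge_subdivision) finite_cubic_arcs: "finite (cubic_arcs G)" "finite (cubic_arcs H)"
proof -
  show "finite (cubic_arcs G)"
    using pair_finite_arcs by (rule rev_finite_subset) (auto simp: cubic_arcs_def)
  interpret H: pair_graph H by (rule pair_graph_H)
  show "finite (cubic_arcs H)"
    using H.pair_finite_arcs by (rule rev_finite_subset) (auto simp: cubic_arcs_def)
qed

lemma (in edge_subdivision) card_cubic_arcs_H: "card (cubic_arcs G) \<le> card (cubic_arcs H) + 2"
proof -
  have "card (cubic_arcs G) - card {(u, v), (v, u)} \<le> card (cubic_arcs G - {(u, v), (v, u)})"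
    by (rule diff_card_le_card_Diff) simp
  also have "\<dots> \<le> card (cubic_arcs H)"
    using finite_cubic_arcs old_cubic_arcs by (intro card_mono)
  finally show ?thesis using ends by simp
qed

text \<open>
  With one leaf the new vertex has degree 3, so the lost edge \<open>uv\<close> is compensated by the edge \<open>uw\<close>.
\<close>

lemma (in edge_subdivision) card_cubic_arcs_H_leaf:
  assumes "(u, v) \<in> cubic_arcs G" "card L = 1"
  shows "card (cubic_arcs G) \<le> card (cubic_arcs H)"
proof -
  let ?new = "{(u, w), (w, u)}"
  have "card (cubic_arcs G) - card {(u, v), (v, u)} + card ?new
      \<le> card (cubic_arcs G - {(u, v), (v, u)}) + card ?new"
    by (intro add_right_mono diff_card_le_card_Diff) simp
  also have "\<dots> = card (cubic_arcs G - {(u, v), (v, u)} \<union> ?new)"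
    using finite_cubic_arcs w_new
    by (intro card_Un_disjoint[symmetric]) (auto simp: cubic_arcs_def dest: wellformed')
  also have "\<dots> \<le> card (cubic_arcs H)"
  proof (rule card_mono)
    have "degree H u = 3" "degree H w = 3"
      using assms ends by (auto simp: cubic_arcs_def degree_old degree_new)
    then show "cubic_arcs G - {(u, v), (v, u)} \<union> ?new \<subseteq> cubic_arcs H"
      using old_cubic_arcs by (auto simp: cubic_arcs_def[of H] parcs_H)
  qed (rule finite_cubic_arcs)
  finally show ?thesis using ends by simp
qed

lemma replace_cubic_edge:
  assumes G: "connected_graph_with_index G k" and cubic: "cubic_arcs G \<noteq> {}"
  shows "\<exists>H. connected_graph_with_index H (k + 10) \<and> has_edge_across_2 H
           \<and> card (cubic_arcs G) \<le> card (cubic_arcs H) + 2"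
    and "\<exists>H. connected_graph_with_index H (k + 8) \<and> has_edge_across_2 H
           \<and> card (cubic_arcs G) \<le> card (cubic_arcs H)"
proof -
  obtain u v where cubic_uv: "(u, v) \<in> cubic_arcs G" using cubic by auto
  then have arc: "(u, v) \<in> parcs G" and deg: "degree G u = 3" "degree G v = 3"
    by (auto simp: cubic_arcs_def)
  have pg: "pair_graph G" using G by (simp add: connected_graph_with_index_def)
  show "\<exists>H. connected_graph_with_index H (k + 10) \<and> has_edge_across_2 H
           \<and> card (cubic_arcs G) \<le> card (cubic_arcs H) + 2"
  proof -
    obtain w L where "edge_subdivision G u v w L" and L: "card L = 0"
      using edge_subdivision_exists[OF pg arc] by metis
    then interpret edge_subdivision G u v w L by blast
    show ?thesis
      using G pair_graph_H connected_H modified_albertson_H has_edge_across_2_H card_cubic_arcs_H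
      by (auto simp: connected_graph_with_index_def deg L)
  qed
  show "\<exists>H. connected_graph_with_index H (k + 8) \<and> has_edge_across_2 H
           \<and> card (cubic_arcs G) \<le> card (cubic_arcs H)"
  proof -
    obtain w L where "edge_subdivision G u v w L" and L: "card L = 1"
      using edge_subdivision_exists[OF pg arc] by metis
    then interpret edge_subdivision G u v w L by blast
    show ?thesis
      using G pair_graph_H connected_H modified_albertson_H has_edge_across_2_H
        card_cubic_arcs_H_leaf[OF cubic_uv L]
      by (auto simp: connected_graph_with_index_def deg L)
  qed
qed

text \<open>
  The \<open>p\<close> steps with a leaf come first, as they keep at least the 12 cubic arcs of \<open>K\<^sub>4\<close>. Each of
  the \<open>s\<close> plain subdivisions then costs at most two, and the bound on \<open>s\<close> leaves a cubic edge to subdivide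
  before each of them. The condition \<open>0 < p + s\<close> excludes \<open>K\<^sub>4\<close> itself, where every degree is 3.
\<close>

lemma exists_graph_8p_10s:
  assumes "s < 6"
  shows "\<exists>G. connected_graph_with_index G (8 * int p + 10 * int s)
      \<and> 12 \<le> card (cubic_arcs G) + 2 * s \<and> (0 < p + s \<longrightarrow> has_edge_across_2 G)"
  using assms
proof (induction s)
  case 0
  show ?case
  proof (induction p)
    case 0
    show ?case
      using complete_graph_with_index_0[of 4] card_cubic_arcs_K4 by auto
  next
    case (Suc p)
    then obtain G where G: "connected_graph_with_index G (8 * int p)" "12 \<le> card (cubic_arcs G)"
      by auto
    then have "cubic_arcs G \<noteq> {}" by auto
    from replace_cubic_edge(2)[OF G(1) this] G(2) show ?case
      by (auto simp: algebra_simps intro: order_trans)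
  qed
next
  case (Suc s)
  then obtain G where G: "connected_graph_with_index G (8 * int p + 10 * int s)"
      "12 \<le> card (cubic_arcs G) + 2 * s"
    by auto
  then have "cubic_arcs G \<noteq> {}" using Suc.prems by auto
  from replace_cubic_edge(1)[OF G(1) this] obtain H where
    "connected_graph_with_index H (8 * int p + 10 * int s + 10)" "has_edge_across_2 H"
    "card (cubic_arcs G) \<le> card (cubic_arcs H) + 2" by blast
  then show ?case
    using G(2) by (intro exI[of _ H]) (auto simp: algebra_simps)
qed

lemma exists_graph_with_index:
  fixes t :: int
  assumes "t \<in> {0, 3, 4, 5} \<union> {8..}"
  shows "\<exists>G. connected_graph_with_index G (2 * t) \<and> has_edge_across_2 G"
proof -
  consider "t = 0" | "t = 3" | "t = 11" | "t \<in> {4, 5, 8, 9, 10} \<union> {12..}"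
    using assms by force
  then show ?thesis
  proof cases
    case 1
    then show ?thesis using subdivide_complete_graph[of 3 0] by simp
  next
    case 2
    then show ?thesis using subdivide_complete_graph[of 2 0] by simp
  next
    case 3
    then show ?thesis using subdivide_complete_graph[of 5 1] by simp
  next
    case 4
    \<comment> \<open>As 5 is congruent to 1 modulo 4, this \<open>s\<close> makes \<open>t - 5 * s\<close> divisible by 4. The numbers for which
      that difference is negative are 1, 2, 3, 6, 7 and 11, all excluded in this case.\<close>
    define s where "s = nat (t mod 4)"
    define p where "p = nat ((t - 5 * int s) div 4)"
    have s: "int s = t mod 4" by (simp add: s_def)
    have "0 \<le> t - 5 * int s"
      using 4 unfolding s by auto presburger
    moreover have "4 dvd t - 5 * int s"
      unfolding s by presburger
    ultimately have "4 * int p + 5 * int s = t" by (auto simp: p_def)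
    then have "2 * t = 8 * int p + 10 * int s" by simp
    moreover have "s < 6" using s pos_mod_bound[of 4 t] by linarith
    moreover have "0 < p + s" using 4 \<open>4 * int p + 5 * int s = t\<close> by auto
    ultimately show ?thesis using exists_graph_8p_10s[of s p] by auto
  qed
qed

section \<open>Enlarging a graph without changing its index\<close>

text \<open>
  The squared degree 4 of the new vertex lies between those of the ends, so its two differences add up
  to the difference along the old edge.
\<close>

lemma subdivide_edge_across_2:
  assumes "connected_graph_with_index G k" "has_edge_across_2 G"
  shows "\<exists>H. connected_graph_with_index H k \<and> has_edge_across_2 H
           \<and> card (pverts H) = Suc (card (pverts G))"
proof -
  have pg: "pair_graph G" using assms by (simp add: connected_graph_with_index_def)
  obtain u v where arc: "(u, v) \<in> parcs G" and deg: "degree G u \<le> 2" "2 \<le> degree G v"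
    using assms by (auto simp: has_edge_across_2_def)
  obtain w L where "edge_subdivision G u v w L" and L: "card L = 0"
    using edge_subdivision_exists[OF pg arc] by metis
  then interpret edge_subdivision G u v w L by blast
  have "(int (degree G u))\<^sup>2 \<le> 2\<^sup>2" "2\<^sup>2 \<le> (int (degree G v))\<^sup>2"
    using deg by (intro power_mono; simp)+
  then have "modified_albertson H = modified_albertson G"
    using modified_albertson_H by (simp add: L)
  then show ?thesis
    using assms pair_graph_H connected_H has_edge_across_2_H card_pverts_H
    by (auto simp: connected_graph_with_index_def L)
qed

lemma exists_larger_graph_with_index:
  assumes "connected_graph_with_index G k" "has_edge_across_2 G"
  shows "\<exists>H. connected_graph_with_index H k \<and> card (pverts H) = card (pverts G) + n"
proof -
  have "\<exists>H. connected_graph_with_index H k \<and> has_edge_across_2 H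
          \<and> card (pverts H) = card (pverts G) + n"
  proof (induction n)
    case 0
    show ?case using assms by auto
  next
    case (Suc n)
    then show ?case using subdivide_edge_across_2 by fastforce
  qed
  then show ?thesis by blast
qed

theorem proposition2p7:
  fixes t :: int
  assumes "t \<in> {0, 3, 4, 5} \<union> {8..}"
  shows "\<exists>S :: nat pair_pre_digraph set. infinite S
    \<and> (\<forall>G\<in>S. pair_graph G \<and> Digraph_Component.connected (with_proj G) \<and> modified_albertson G = 2 * t)
    \<and> (\<forall>G\<in>S. \<forall>H\<in>S. G \<noteq> H \<longrightarrow> \<not> digraph_iso (with_proj G) (with_proj H))"
proof -
  obtain G where "connected_graph_with_index G (2 * t)" "has_edge_across_2 G"
    using exists_graph_with_index[OF assms] by blast
  then have "\<forall>n. \<exists>H. connected_graph_with_index H (2 * t) \<and> card (pverts H) = card (pverts G) + n"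
    using exists_larger_graph_with_index by blast
  then obtain F where F: "\<And>n. connected_graph_with_index (F n) (2 * t)"
      "\<And>n. card (pverts (F n)) = card (pverts G) + n"
    by metis
  have "inj F"
    by (rule injI) (metis F(2) add_left_cancel)
  then have "infinite (range F)"
    by (simp add: finite_image_iff)
  moreover have "\<not> digraph_iso (with_proj (F m)) (with_proj (F n))" if "F m \<noteq> F n" for m n
    using that digraph_iso_card_pverts[of "F m" "F n"] F(2) by auto
  ultimately show ?thesis
    using F(1) by (intro exI[of _ "range F"]) (auto simp: connected_graph_with_index_def)
qed

end
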